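(* Let $d \ge 3$. Let $m_1,m_2,n_1,n_2$ be four distinct integers in $\{0,1,\dots,d\}$, with $\{m_1,m_2\} \ne \{0,1\}$ and $\{m_1,m_2\}\ne\{d-1,d\}$, and set $\mathcal{B}=\{m_1,m_2,n_1,n_2\}$. Then for a general binary form $p \in H_d(\mathbb{C}^2)$ there exist an invertible linear change of variables $(X,Y) = (\alpha_1x+\alpha_2y,\ \alpha_3x+\alpha_4y)$ and constants $t_k\in\mathbb{C}$ ($k\in\{0,\dots,d\}\setminus\mathcal{B}$) such that $$p(x,y) = X^{d-n_1}Y^{n_1} + X^{d-n_2}Y^{n_2} + \sum_{k \in \{0,\dots,d\}\setminus \mathcal{B}} t_k X^{d-k}Y^k.$$ In particular, the monomials $X^{d-m_1}Y^{m_1}$ and $X^{d-m_2}Y^{m_2}$ do not appear.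
   Context: $H_d(\mathbb{C}^n)$ denotes the complex vector space of homogeneous polynomials of degree $d$ in $n$ variables. "A general $p$ has property P" means P holds for all $p$ in a nonempty Zariski-open subset of $H_d(\mathbb{C}^n)$. *)

theory Defs
  imports Complex_Main
begin

text \<open>A binary form p in H_d(C^2) is identified with its coefficient vector
  c : nat => complex, with c k = 0 for k > d, via
  p(x,y) = sum_{k=0..d} c k * x^(d-k) * y^k.\<close>

definition forms_space :: "nat \<Rightarrow> (nat \<Rightarrow> complex) set" where
  "forms_space d = {c. \<forall>k>d. c k = 0}"

definition binary_form :: "nat \<Rightarrow> (nat \<Rightarrow> complex) \<Rightarrow> complex \<Rightarrow> complex \<Rightarrow> complex" where
  "binary_form d c x y = (\<Sum>k=0..d. c k * x ^ (d - k) * y ^ k)"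

inductive_set poly_fun :: "nat \<Rightarrow> ((nat \<Rightarrow> complex) \<Rightarrow> complex) set" for d :: nat where
  pf_const: "(\<lambda>c. a) \<in> poly_fun d"
| pf_var: "i \<le> d \<Longrightarrow> (\<lambda>c. c i) \<in> poly_fun d"
| pf_add: "f \<in> poly_fun d \<Longrightarrow> g \<in> poly_fun d \<Longrightarrow> (\<lambda>c. f c + g c) \<in> poly_fun d"
| pf_mult: "f \<in> poly_fun d \<Longrightarrow> g \<in> poly_fun d \<Longrightarrow> (\<lambda>c. f c * g c) \<in> poly_fun d"

definition zariski_open :: "nat \<Rightarrow> (nat \<Rightarrow> complex) set \<Rightarrow> bool" where
  "zariski_open d U \<longleftrightarrow> (\<exists>S \<subseteq> poly_fun d.
      U = forms_space d - {c \<in> forms_space d. \<forall>q\<in>S. q c = 0})"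

definition general :: "nat \<Rightarrow> ((nat \<Rightarrow> complex) \<Rightarrow> bool) \<Rightarrow> bool" where
  "general d P \<longleftrightarrow> (\<exists>U. zariski_open d U \<and> U \<noteq> {} \<and> (\<forall>c\<in>U. P c))"

end

theory Submission
  imports Defs "HOL-Computational_Algebra.Fundamental_Theorem_Algebra"
begin

text \<open>The forms with the required normal form are the image of a polynomial map in the
  \<open>a\<^sub>i\<close> and \<open>t\<^sub>k\<close>, hence (quantifier elimination over the complex numbers) membership of \<open>c\<close> in
  the image depends only on which members of a finite set of polynomials vanish at \<open>c\<close>. Off
  the zeros of the nonzero ones it is therefore constant, and it suffices that the image be
  Zariski dense. Density holds because the differential is onto at one point: take the
  identity change of variables and all free \<open>t\<^sub>k\<close> equal to 1. There the surjectivity comes down to a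
  2 by 2 minor in the coefficients \<open>m1\<close>, \<open>m2\<close> of \<open>Y dp/dX\<close> and \<open>X dp/dY\<close>,
  which vanishes exactly in the two excluded cases.\<close>

section \<open>Polynomial functions and polynomials depending on parameters\<close>

text \<open>Coordinates above \<open>n\<close> never enter, so coefficient vectors may be changed
  there at will.\<close>

lemma poly_fun_cong:
  assumes "f \<in> poly_fun n" "\<And>i. i \<le> n \<Longrightarrow> c i = e i"
  shows "f c = f e"
  using assms by induction auto

lemma poly_fun_diff:
  assumes "f \<in> poly_fun n" "g \<in> poly_fun n"
  shows "(\<lambda>c. f c - g c) \<in> poly_fun n"
proof -
  have "(\<lambda>c. f c + (\<lambda>c. -1) c * g c) \<in> poly_fun n"
    by (intro poly_fun.intros assms)
  then show ?thesis by simp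
qed

lemma poly_fun_sum:
  assumes "\<And>i. i \<in> A \<Longrightarrow> f i \<in> poly_fun n"
  shows "(\<lambda>c. \<Sum>i\<in>A. f i c) \<in> poly_fun n"
  using assms by (induction A rule: infinite_finite_induct) (auto intro: poly_fun.intros)

lemma poly_fun_prod:
  assumes "\<And>i. i \<in> A \<Longrightarrow> f i \<in> poly_fun n"
  shows "(\<lambda>c. \<Prod>i\<in>A. f i c) \<in> poly_fun n"
  using assms by (induction A rule: infinite_finite_induct) (auto intro: poly_fun.intros)

text \<open>Continuity in finitely many coordinates, stated coordinatewise so that no topology on
  \<open>nat => complex\<close> is involved.\<close>

lemma poly_fun_tendsto:
  assumes "f \<in> poly_fun n" "\<And>i. i \<le> n \<Longrightarrow> ((\<lambda>x. g x i) \<longlongrightarrow> l i) F"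
  shows "((\<lambda>x. f (g x)) \<longlongrightarrow> f l) F"
  using assms by induction (auto intro!: tendsto_intros)

text \<open>\<open>D\<close> bounds the number of coefficients: the degree is less than \<open>D\<close>, and \<open>D = 0\<close> means \<open>T = 0\<close>.\<close>
definition poly_family :: "nat \<Rightarrow> ((nat \<Rightarrow> complex) \<Rightarrow> complex poly) \<Rightarrow> nat \<Rightarrow> bool" where
  "poly_family n T D \<longleftrightarrow>
     (\<forall>i. (\<lambda>c. coeff (T c) i) \<in> poly_fun n) \<and> (\<forall>c. \<forall>i\<ge>D. coeff (T c) i = 0)"

lemma poly_familyI:
  assumes "\<And>i. (\<lambda>c. coeff (T c) i) \<in> poly_fun n" "\<And>c i. i \<ge> D \<Longrightarrow> coeff (T c) i = 0"
  shows "poly_family n T D"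
  using assms by (auto simp: poly_family_def)

lemma poly_family_coeff: "poly_family n T D \<Longrightarrow> (\<lambda>c. coeff (T c) i) \<in> poly_fun n"
  by (simp add: poly_family_def)

lemma poly_family_vanish: "poly_family n T D \<Longrightarrow> D \<le> i \<Longrightarrow> coeff (T c) i = 0"
  by (simp add: poly_family_def)

lemma poly_family_zero: "poly_family n T 0 \<Longrightarrow> T c = 0"
  by (simp add: poly_family_def poly_eq_iff)

lemma poly_family_mono: "poly_family n T D \<Longrightarrow> D \<le> E \<Longrightarrow> poly_family n T E"
  by (auto simp: poly_family_def)

lemma poly_family_pCons:
  assumes "f \<in> poly_fun n" "poly_family n T D"
  shows "poly_family n (\<lambda>c. pCons (f c) (T c)) (Suc D)"
proof (rule poly_familyI)
  fix i show "(\<lambda>c. coeff (pCons (f c) (T c)) i) \<in> poly_fun n"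
    using assms by (cases i) (auto simp: poly_family_def)
qed (use assms in \<open>auto simp: poly_family_def coeff_pCons split: nat.splits\<close>)

lemma poly_family_const: "f \<in> poly_fun n \<Longrightarrow> poly_family n (\<lambda>c. [:f c:]) 1"
  using poly_family_pCons[of f n "\<lambda>c. 0" 0] by (simp add: poly_family_def poly_fun.intros)

lemma poly_family_linear:
  assumes "f \<in> poly_fun n" "g \<in> poly_fun n"
  shows "poly_family n (\<lambda>c. [:f c, g c:]) 2"
  using poly_family_pCons[OF assms(1) poly_family_const[OF assms(2)]] by (simp add: numeral_2_eq_2)

lemma poly_family_add:
  assumes "poly_family n S D" "poly_family n T E"
  shows "poly_family n (\<lambda>c. S c + T c) (max D E)"
  using assms by (auto simp: poly_family_def intro: poly_fun.intros)

lemma poly_family_mult: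
  assumes S: "poly_family n S D" and T: "poly_family n T E"
  shows "poly_family n (\<lambda>c. S c * T c) (D + E)"
proof (rule poly_familyI)
  fix i show "(\<lambda>c. coeff (S c * T c) i) \<in> poly_fun n"
    unfolding coeff_mult
    by (intro poly_fun_sum poly_fun.pf_mult poly_family_coeff[OF S] poly_family_coeff[OF T])
next
  fix c i assume "D + E \<le> i"
  show "coeff (S c * T c) i = 0" unfolding coeff_mult
  proof (intro sum.neutral ballI)
    fix k assume "k \<in> {..i}"
    then have "D \<le> k \<or> E \<le> i - k" using \<open>D + E \<le> i\<close> by auto
    then show "coeff (S c) k * coeff (T c) (i - k) = 0"
      using poly_family_vanish[OF S] poly_family_vanish[OF T] by auto
  qed
qed

lemma poly_family_smult:
  assumes f: "f \<in> poly_fun n" and T: "poly_family n T D"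
  shows "poly_family n (\<lambda>c. smult (f c) (T c)) D"
  using T by (auto simp: poly_family_def intro: poly_fun.intros f)

lemma poly_family_power:
  assumes "poly_family n T D"
  shows "\<exists>E. poly_family n (\<lambda>c. T c ^ k) E"
proof (induction k)
  case 0
  show ?case using poly_family_const[OF poly_fun.pf_const[of 1]] by (auto simp: one_pCons)
next
  case (Suc k)
  then show ?case using poly_family_mult[OF assms] by auto
qed

lemma poly_family_sum:
  assumes "\<And>i. i \<in> A \<Longrightarrow> \<exists>D. poly_family n (T i) D"
  shows "\<exists>D. poly_family n (\<lambda>c. \<Sum>i\<in>A. T i c) D"
  using assms
proof (induction A rule: infinite_finite_induct)
  case (insert a A)
  obtain D where D: "poly_family n (T a) D" using insert.prems by blast
  obtain E where E: "poly_family n (\<lambda>c. \<Sum>i\<in>A. T i c) E" using insert.IH insert.prems by blast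
  from poly_family_add[OF D E] insert.hyps show ?case by auto
qed (auto simp: poly_family_def intro!: exI[of _ 0] poly_fun.intros)

text \<open>Sorts \<open>f\<close> by powers of its last variable. The bound \<open>D\<close> is
  uniform in \<open>c\<close>, and the coefficients are polynomial in the remaining variables: the
  form needed to eliminate that variable.\<close>

lemma poly_fun_Suc_poly:
  assumes "f \<in> poly_fun (Suc n)"
  shows "\<exists>T D. poly_family n T D \<and> (\<forall>c x. f (c(Suc n := x)) = poly (T c) x)"
  using assms
proof induction
  case (pf_const a)
  show ?case
    by (intro exI[of _ "\<lambda>c. [:a:]"] exI[of _ 1] conjI poly_family_const poly_fun.pf_const) simp
next
  case (pf_var i)
  show ?case
  proof (cases "i = Suc n")
    case True
    then show ?thesis
      by (intro exI[of _ "\<lambda>c. [:0, 1:]"] exI[of _ 2] conjI poly_family_linear poly_fun.pf_const) simp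
  next
    case False
    with pf_var show ?thesis
      by (intro exI[of _ "\<lambda>c. [:c i:]"] exI[of _ 1] conjI poly_family_const poly_fun.pf_var) auto
  qed
next
  case (pf_add f g)
  then obtain S D T E where "poly_family n S D" "poly_family n T E"
    "\<And>c x. f (c(Suc n := x)) = poly (S c) x" "\<And>c x. g (c(Suc n := x)) = poly (T c) x" by blast
  then show ?case
    by (intro exI[of _ "\<lambda>c. S c + T c"] exI[of _ "max D E"] conjI poly_family_add) (simp_all del: fun_upd_apply)
next
  case (pf_mult f g)
  then obtain S D T E where "poly_family n S D" "poly_family n T E"
    "\<And>c x. f (c(Suc n := x)) = poly (S c) x" "\<And>c x. g (c(Suc n := x)) = poly (T c) x" by blast
  then show ?case
    by (intro exI[of _ "\<lambda>c. S c * T c"] exI[of _ "D + E"] conjI poly_family_mult) (simp_all del: fun_upd_apply)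
qed

text \<open>Taylor expansion of \<open>f\<close> at \<open>a\<close> along the direction
  \<open>h\<close>. The coefficient of \<open>x ^ j\<close> is the part homogeneous of degree
  \<open>j\<close> in \<open>h\<close>; only its polynomial dependence on \<open>h\<close> and a
  uniform bound are recorded.\<close>

lemma poly_fun_taylor:
  assumes "f \<in> poly_fun n"
  shows "\<exists>T D. poly_family n T D \<and> (\<forall>h x. f (\<lambda>i. a i + x * h i) = poly (T h) x)"
  using assms
proof induction
  case (pf_const b)
  show ?case
    by (intro exI[of _ "\<lambda>c. [:b:]"] exI[of _ 1] conjI poly_family_const poly_fun.pf_const) simp
next
  case (pf_var i)
  then show ?case
    by (intro exI[of _ "\<lambda>h. [:a i, h i:]"] exI[of _ 2] conjI poly_family_linear
        poly_fun.pf_const poly_fun.pf_var) auto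
next
  case (pf_add f g)
  then obtain S D T E where "poly_family n S D" "poly_family n T E"
    "\<And>h x. f (\<lambda>i. a i + x * h i) = poly (S h) x" "\<And>h x. g (\<lambda>i. a i + x * h i) = poly (T h) x" by blast
  then show ?case
    by (intro exI[of _ "\<lambda>c. S c + T c"] exI[of _ "max D E"] conjI poly_family_add) (simp_all del: fun_upd_apply)
next
  case (pf_mult f g)
  then obtain S D T E where "poly_family n S D" "poly_family n T E"
    "\<And>h x. f (\<lambda>i. a i + x * h i) = poly (S h) x" "\<And>h x. g (\<lambda>i. a i + x * h i) = poly (T h) x" by blast
  then show ?case
    by (intro exI[of _ "\<lambda>c. S c * T c"] exI[of _ "D + E"] conjI poly_family_mult) (simp_all del: fun_upd_apply)
qed

text \<open>On the line through \<open>a\<close> and \<open>b\<close> both functions become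
  univariate polynomials, nonzero at parameters 0 and 1 respectively. Their product is a nonzero
  polynomial, hence nonzero at some point of the line.\<close>

lemma poly_fun_mult_nonzero:
  assumes f: "f \<in> poly_fun n" "f a \<noteq> 0" and g: "g \<in> poly_fun n" "g b \<noteq> 0"
  shows "\<exists>c. f c * g c \<noteq> 0"
proof -
  define h where "h = (\<lambda>i. b i - a i)"
  obtain S where S: "\<And>h x. f (\<lambda>i. a i + x * h i) = poly (S h) x"
    using poly_fun_taylor[OF f(1)] by blast
  obtain T where T: "\<And>h x. g (\<lambda>i. a i + x * h i) = poly (T h) x"
    using poly_fun_taylor[OF g(1)] by blast
  have "poly (S h) 0 \<noteq> 0" using f(2) by (simp flip: S)
  moreover have "poly (T h) 1 \<noteq> 0" using g(2) by (simp flip: T add: h_def)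
  ultimately have "S h * T h \<noteq> 0" by auto
  then obtain x where "poly (S h * T h) x \<noteq> 0"
    using poly_all_0_iff_0 by blast
  then show ?thesis by (metis S T poly_mult)
qed

lemma poly_fun_prod_nonzero:
  assumes "finite A" "\<And>f. f \<in> A \<Longrightarrow> f \<in> poly_fun n \<and> (\<exists>c. f c \<noteq> 0)"
  shows "\<exists>c. (\<Prod>f\<in>A. f c) \<noteq> 0"
  using assms
proof (induction A)
  case (insert f A)
  then obtain a b where "f a \<noteq> 0" "(\<Prod>f\<in>A. f b) \<noteq> 0" by blast
  moreover have "(\<lambda>c. \<Prod>f\<in>A. f c) \<in> poly_fun n"
    by (rule poly_fun_prod) (use insert.prems in auto)
  ultimately have "\<exists>c. f c * (\<Prod>f\<in>A. f c) \<noteq> 0"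
    using poly_fun_mult_nonzero[of f n a "\<lambda>c. \<Prod>f\<in>A. f c" b] insert.prems by blast
  then show ?case using insert.hyps by simp
qed auto

section \<open>Constructible predicates and quantifier elimination\<close>

text \<open>A Boolean combination of polynomial equations, expressed without syntax.\<close>
definition constructible :: "nat \<Rightarrow> ((nat \<Rightarrow> complex) \<Rightarrow> bool) \<Rightarrow> bool" where
  "constructible n P \<longleftrightarrow> (\<exists>F. finite F \<and> F \<subseteq> poly_fun n \<and>
     (\<forall>c e. (\<forall>f\<in>F. f c = 0 \<longleftrightarrow> f e = 0) \<longrightarrow> P c = P e))"

lemma constructibleI:
  assumes "finite F" "F \<subseteq> poly_fun n"
    "\<And>c e. (\<And>f. f \<in> F \<Longrightarrow> f c = 0 \<longleftrightarrow> f e = 0) \<Longrightarrow> P c = P e"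
  shows "constructible n P"
  unfolding constructible_def
proof (intro exI[of _ F] conjI allI impI)
  fix c e assume "\<forall>f\<in>F. f c = 0 \<longleftrightarrow> f e = 0"
  then show "P c = P e" by (intro assms(3)) blast
qed (rule assms)+

lemma constructibleE:
  assumes "constructible n P"
  obtains F where "finite F" "F \<subseteq> poly_fun n"
    "\<forall>c e. (\<forall>f\<in>F. f c = 0 \<longleftrightarrow> f e = 0) \<longrightarrow> P c = P e"
  using assms unfolding constructible_def by (elim exE conjE) (rule that)

lemma constructible_zero: "f \<in> poly_fun n \<Longrightarrow> constructible n (\<lambda>c. f c = 0)"
  by (rule constructibleI[of "{f}"]) auto

lemma constructible_const: "constructible n (\<lambda>c. b)"
  by (rule constructibleI[of "{}"]) auto

lemma constructible_not:
  assumes "constructible n P"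
  shows "constructible n (\<lambda>c. \<not> P c)"
  using assms
proof (rule constructibleE)
  fix F assume F: "finite F" "F \<subseteq> poly_fun n"
    "\<forall>c e. (\<forall>f\<in>F. f c = 0 \<longleftrightarrow> f e = 0) \<longrightarrow> P c = P e"
  show ?thesis
  proof (rule constructibleI[OF F(1,2)])
    fix c e assume "\<And>f. f \<in> F \<Longrightarrow> f c = 0 \<longleftrightarrow> f e = 0"
    from F(3)[rule_format, OF this] show "(\<not> P c) = (\<not> P e)" by simp
  qed
qed

lemma constructible_conj:
  assumes "constructible n P" "constructible n Q"
  shows "constructible n (\<lambda>c. P c \<and> Q c)"
proof -
  obtain F where F: "finite F" "F \<subseteq> poly_fun n"
    "\<forall>c e. (\<forall>f\<in>F. f c = 0 \<longleftrightarrow> f e = 0) \<longrightarrow> P c = P e"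
    using assms(1) by (rule constructibleE) (rule that)
  obtain G where G: "finite G" "G \<subseteq> poly_fun n"
    "\<forall>c e. (\<forall>f\<in>G. f c = 0 \<longleftrightarrow> f e = 0) \<longrightarrow> Q c = Q e"
    using assms(2) by (rule constructibleE) (rule that)
  show ?thesis
  proof (rule constructibleI[of "F \<union> G"])
    fix c e assume eq: "\<And>f. f \<in> F \<union> G \<Longrightarrow> f c = 0 \<longleftrightarrow> f e = 0"
    have "P c = P e" "Q c = Q e" by (rule F(3)[rule_format] G(3)[rule_format], rule eq, simp)+
    then show "(P c \<and> Q c) = (P e \<and> Q e)" by simp
  qed (use F(1,2) G(1,2) in auto)
qed

lemma constructible_disj:
  assumes "constructible n P" "constructible n Q"
  shows "constructible n (\<lambda>c. P c \<or> Q c)"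
  using constructible_not[OF constructible_conj[OF assms[THEN constructible_not]]] by simp

lemma constructible_if:
  assumes "constructible n B" "constructible n P" "constructible n Q"
  shows "constructible n (\<lambda>c. if B c then P c else Q c)"
proof -
  have "constructible n (\<lambda>c. B c \<and> P c \<or> \<not> B c \<and> Q c)"
    by (intro constructible_disj constructible_conj constructible_not assms)
  then show ?thesis by (rule back_subst[of "constructible n"]) auto
qed

lemma constructible_bex:
  assumes "finite A" "\<And>i. i \<in> A \<Longrightarrow> constructible n (P i)"
  shows "constructible n (\<lambda>c. \<exists>i\<in>A. P i c)"
  using assms by (induction A) (auto intro: constructible_const constructible_disj)

lemma constructible_ball:
  assumes "finite A" "\<And>i. i \<in> A \<Longrightarrow> constructible n (P i)"
  shows "constructible n (\<lambda>c. \<forall>i\<in>A. P i c)"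
  using assms by (induction A) (auto intro: constructible_const constructible_conj)

section \<open>Elimination of one variable by pseudo-division\<close>

lemma constructible_poly_family_zero:
  assumes "poly_family n T D"
  shows "constructible n (\<lambda>c. T c = 0)"
proof -
  have "T c = 0 \<longleftrightarrow> (\<forall>i\<in>{..<D}. coeff (T c) i = 0)" for c
  proof
    assume *: "\<forall>i\<in>{..<D}. coeff (T c) i = 0"
    show "T c = 0"
    proof (rule poly_eqI)
      fix i show "coeff (T c) i = coeff 0 i"
        using * poly_family_vanish[OF assms, of i c] by (cases "i < D") auto
    qed
  qed simp
  moreover have "constructible n (\<lambda>c. \<forall>i\<in>{..<D}. coeff (T c) i = 0)"
    by (intro constructible_ball constructible_zero poly_family_coeff[OF assms]) simp
  ultimately show ?thesis by simp
qed

text \<open>Cancels the top coefficient of \<open>S\<close> against that of \<open>T\<close>.\<close>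
definition reduct :: "nat \<Rightarrow> nat \<Rightarrow> complex poly \<Rightarrow> complex poly \<Rightarrow> complex poly" where
  "reduct E D S T = smult (coeff T D) S - monom (coeff S E) (E - D) * T"

text \<open>The leading terms cancel, so the bound drops by one while the coefficients stay
  polynomial in the parameters.\<close>

lemma poly_family_reduct:
  assumes S: "poly_family n S (Suc E)" and T: "poly_family n T (Suc D)" and "D \<le> E"
  shows "poly_family n (\<lambda>c. reduct E D (S c) (T c)) E"
proof (rule poly_familyI)
  fix i
  show "(\<lambda>c. coeff (reduct E D (S c) (T c)) i) \<in> poly_fun n"
    unfolding reduct_def coeff_diff coeff_smult coeff_monom_mult
    by (cases "E - D \<le> i"; simp)
      (intro poly_fun_diff poly_fun.pf_mult poly_fun.pf_const poly_family_coeff[OF S] poly_family_coeff[OF T])+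
next
  fix c i assume "E \<le> i"
  then consider "i = E" | "Suc E \<le> i" by linarith
  then show "coeff (reduct E D (S c) (T c)) i = 0"
  proof cases
    case 1
    then show ?thesis using \<open>D \<le> E\<close> by (simp add: reduct_def coeff_monom_mult)
  next
    case 2
    moreover have "Suc D \<le> i - (E - D)" using 2 \<open>D \<le> E\<close> by linarith
    ultimately show ?thesis
      using poly_family_vanish[OF S] poly_family_vanish[OF T] by (simp add: reduct_def coeff_monom_mult)
  qed
qed

text \<open>Serves the branch where the top coefficient vanishes: the polynomial is then unchanged,
  but carries a smaller bound.\<close>

lemma poly_family_truncate:
  assumes T: "poly_family n T (Suc D)"
  shows "poly_family n (\<lambda>c. T c - monom (coeff (T c) D) D) D"
proof (rule poly_familyI)
  fix i
  show "(\<lambda>c. coeff (T c - monom (coeff (T c) D) D) i) \<in> poly_fun n"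
    using poly_family_coeff[OF T] by (cases "D = i") (auto intro: poly_fun.pf_const)
next
  fix c i assume "D \<le> i"
  then show "coeff (T c - monom (coeff (T c) D) D) i = 0"
    using poly_family_vanish[OF T, of i c] by (cases "D = i") auto
qed

text \<open>Repeated use of \<open>reduct\<close>. Scaling by the leading coefficient replaces
  division by it, so the remainder is again a polynomial family; the exponent \<open>k\<close> is
  the same for all parameters.\<close>

lemma poly_family_pseudo_mod:
  assumes T: "poly_family n T (Suc D)" and "poly_family n U E"
  shows "\<exists>R k. poly_family n R D \<and>
           (\<forall>c. \<exists>q. smult (coeff (T c) D ^ k) (U c) = q * T c + R c)"
  using assms(2)
proof (induction E arbitrary: U)
  case 0
  show ?case
    by (intro exI[of _ U] exI[of _ 0] conjI poly_family_mono[OF 0] allI exI[of _ 0]) auto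
next
  case (Suc E)
  show ?case
  proof (cases "D \<le> E")
    case True
    obtain R k where R: "poly_family n R D"
      "\<And>c. \<exists>q. smult (coeff (T c) D ^ k) (reduct E D (U c) (T c)) = q * T c + R c"
      using Suc.IH[OF poly_family_reduct[OF Suc.prems T True]] by blast
    have "\<exists>q. smult (coeff (T c) D ^ Suc k) (U c) = q * T c + R c" for c
    proof -
      obtain q where q: "smult (coeff (T c) D ^ k) (reduct E D (U c) (T c)) = q * T c + R c"
        using R(2) by blast
      have "smult (coeff (T c) D ^ Suc k) (U c)
          = smult (coeff (T c) D ^ k) (reduct E D (U c) (T c))
            + smult (coeff (T c) D ^ k) (monom (coeff (U c) E) (E - D)) * T c"
        by (simp add: reduct_def smult_diff_right mult.commute)
      also have "\<dots> = (q + smult (coeff (T c) D ^ k) (monom (coeff (U c) E) (E - D))) * T c + R c"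
        by (simp add: q algebra_simps)
      finally show ?thesis by blast
    qed
    with R(1) show ?thesis by blast
  next
    case False
    then show ?thesis
      by (intro exI[of _ U] exI[of _ 0] conjI poly_family_mono[OF Suc.prems] allI exI[of _ 0]) auto
  qed
qed

text \<open>By the univariate Nullstellensatz, solvability fails exactly when \<open>T c\<close>
  divides a power of \<open>U c\<close>, that is, when a pseudo-remainder vanishes identically. This
  is a condition on finitely many polynomial functions of \<open>c\<close>.\<close>

lemma constructible_single:
  assumes T: "poly_family n T (Suc D)" and U: "poly_family n U E"
  shows "\<exists>P. constructible n P \<and>
    (\<forall>c. coeff (T c) D \<noteq> 0 \<longrightarrow> P c = (\<exists>x. poly (T c) x = 0 \<and> poly (U c) x \<noteq> 0))"
proof -
  obtain E' where "poly_family n (\<lambda>c. U c ^ D) E'" using poly_family_power[OF U] by blast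
  from poly_family_pseudo_mod[OF T this] obtain R k where R: "poly_family n R D"
    "\<And>c. \<exists>q. smult (coeff (T c) D ^ k) (U c ^ D) = q * T c + R c" by blast
  have "(\<not> R c = 0) = (\<exists>x. poly (T c) x = 0 \<and> poly (U c) x \<noteq> 0)" if l: "coeff (T c) D \<noteq> 0" for c
  proof -
    obtain q where q: "smult (coeff (T c) D ^ k) (U c ^ D) = q * T c + R c" using R(2) by blast
    have deg: "degree (T c) = D"
      using l poly_family_vanish[OF T] by (intro antisym degree_le le_degree) auto
    \<comment> \<open>The exponent \<open>D\<close> suffices because a root of \<open>T c\<close>
      has multiplicity at most its degree.\<close>
    have "(\<forall>x. poly (T c) x = 0 \<longrightarrow> poly (U c) x = 0) \<longleftrightarrow> T c dvd U c ^ D"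
      using nullstellensatz_univariate[of "T c" "U c"] l deg by auto
    also have "\<dots> \<longleftrightarrow> T c dvd smult (coeff (T c) D ^ k) (U c ^ D)"
      using l by (simp add: dvd_smult_iff)
    also have "\<dots> \<longleftrightarrow> T c dvd R c" unfolding q by (simp add: dvd_add_right_iff)
    \<comment> \<open>The bound \<open>D\<close> on \<open>R\<close> means degree less than
      \<open>D\<close>, so \<open>T c\<close>, of degree exactly \<open>D\<close>, divides
      \<open>R c\<close> only if \<open>R c\<close> is zero.\<close>
    also have "\<dots> \<longleftrightarrow> R c = 0"
    proof
      assume dvd: "T c dvd R c"
      show "R c = 0"
      proof (rule ccontr)
        assume "R c \<noteq> 0"
        with dvd have "D \<le> degree (R c)" using dvd_imp_degree_le deg by metis
        then have "lead_coeff (R c) = 0" using poly_family_vanish[OF R(1)] by blast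
        with \<open>R c \<noteq> 0\<close> show False by simp
      qed
    qed simp
    finally show ?thesis by blast
  qed
  with constructible_not[OF constructible_poly_family_zero[OF R(1)]] show ?thesis by blast
qed

text \<open>The Euclidean algorithm with parameters: of two equations the one with the larger bound
  is reduced by the other, branching on whether the leading coefficient of the latter vanishes. This
  ends with a single equation, or with none, where \<open>U c\<close> has to be a nonzero
  polynomial.\<close>

lemma constructible_system:
  assumes U: "poly_family n U E"
    and "\<forall>(T, D)\<in>set L. poly_family n T D"
  shows "constructible n (\<lambda>c. \<exists>x. (\<forall>(T, D)\<in>set L. poly (T c) x = 0) \<and> poly (U c) x \<noteq> 0)"
  using assms(2)
\<comment> \<open>Counting \<open>Suc D\<close> instead of \<open>D\<close> makes the measure drop
  also when a trivial equation with \<open>D = 0\<close> is removed.\<close>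
proof (induction "\<Sum>(T, D)\<leftarrow>L. Suc D" arbitrary: L rule: less_induct)
  case less
  let ?P = "\<lambda>L c. \<exists>x. (\<forall>(T, D :: nat)\<in>set L. poly (T c) x = 0) \<and> poly (U c) x \<noteq> 0"
  have two: "constructible n (?P ((T, D) # (S, E) # L'))"
    if sum: "(\<Sum>(T, D)\<leftarrow>L. Suc D) = (\<Sum>(T, D)\<leftarrow>(T, D) # (S, E) # L'. Suc D)"
      and fam: "\<forall>(T, D)\<in>set ((T, D) # (S, E) # L'). poly_family n T D" and "D \<le> E" for T D S E L'
  proof (cases D)
    case 0
    have "constructible n (?P ((S, E) # L'))"
      by (rule less.hyps) (use sum fam in auto)
    then show ?thesis using fam poly_family_zero[of n T] 0 by auto
  next
    case (Suc D')
    then obtain E' where E': "E = Suc E'" "D' \<le> E'" using \<open>D \<le> E\<close> by (cases E) auto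
    have T: "poly_family n T (Suc D')" and S: "poly_family n S (Suc E')" using fam Suc E' by auto
    let ?T = "\<lambda>c. T c - monom (coeff (T c) D') D'"
    let ?S = "\<lambda>c. reduct E' D' (S c) (T c)"
    have 1: "constructible n (?P ((?T, D') # (S, E) # L'))"
      by (rule less.hyps) (use sum fam Suc poly_family_truncate[OF T] in auto)
    have 2: "constructible n (?P ((T, D) # (?S, E') # L'))"
      by (rule less.hyps) (use sum fam E' poly_family_reduct[OF S T E'(2)] in auto)
    have "?P ((T, D) # (S, E) # L') c =
      (if coeff (T c) D' = 0 then ?P ((?T, D') # (S, E) # L') c else ?P ((T, D) # (?S, E') # L') c)" for c
    proof (cases "coeff (T c) D' = 0")
      case False
      \<comment> \<open>At a root of \<open>T c\<close>, the reduct is the nonzero leading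
        coefficient times \<open>S c\<close>, so replacing \<open>S\<close> keeps the solution
        set.\<close>
      have "poly (S c) x = 0 \<longleftrightarrow> poly (?S c) x = 0" if "poly (T c) x = 0" for x
        using that False by (simp add: reduct_def)
      with False show ?thesis by auto
    qed simp
    then show ?thesis
      using constructible_if[OF constructible_zero[OF poly_family_coeff[OF T]] 1 2] by simp
  qed
  consider "L = []" | T D where "L = [(T, D)]" | T D S E' L' where "L = (T, D) # (S, E') # L'"
    by (metis list.exhaust surj_pair)
  then show ?case
  proof cases
    case 1
    have "(\<exists>x. poly (U c) x \<noteq> 0) \<longleftrightarrow> U c \<noteq> 0" for c
      using poly_all_0_iff_0[of "U c"] by blast
    then show ?thesis using constructible_not[OF constructible_poly_family_zero[OF U]] 1 by simp
  next
    case 2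
    show ?thesis
    proof (cases D)
      case 0
      have "constructible n (?P [])"
        by (rule less.hyps) (use 2 in auto)
      then show ?thesis using less.prems poly_family_zero[of n T] 0 2 by auto
    next
      case (Suc D')
      have T: "poly_family n T (Suc D')" using less.prems 2 Suc by auto
      let ?T = "\<lambda>c. T c - monom (coeff (T c) D') D'"
      have 1: "constructible n (?P [(?T, D')])"
        by (rule less.hyps) (use less.prems 2 Suc poly_family_truncate[OF T] in auto)
      obtain Q where Q: "constructible n Q"
        "\<And>c. coeff (T c) D' \<noteq> 0 \<Longrightarrow> Q c = (\<exists>x. poly (T c) x = 0 \<and> poly (U c) x \<noteq> 0)"
        using constructible_single[OF T U] by blast
      have "?P L c = (if coeff (T c) D' = 0 then ?P [(?T, D')] c else Q c)" for c
        using Q(2)[of c] 2 by auto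
      then show ?thesis
        using constructible_if[OF constructible_zero[OF poly_family_coeff[OF T]] 1 Q(1)] by simp
    qed
  next
    case 3
    show ?thesis
    proof (cases "D \<le> E'")
      case True
      then show ?thesis using two[of T D S E' L'] less.prems 3 by auto
    next
      case False
      \<comment> \<open>Only the set of equations matters, so the two may be swapped to put the
        smaller bound first.\<close>
      have eq: "set L = set ((S, E') # (T, D) # L')" using 3 by auto
      show ?thesis unfolding eq
        by (rule two) (use less.prems 3 False in auto)
    qed
  qed
qed

text \<open>\<open>P\<close> is a finite disjunction over vanishing patterns on \<open>F\<close>.
  Each pattern is a system of equations with a single inequation, the product of the remaining
  members of \<open>F\<close> being nonzero, and the quantifier passes through the
  disjunction.\<close>

lemma constructible_Ex:
  assumes "constructible (Suc n) P"
  shows "constructible n (\<lambda>c. \<exists>x. P (c(Suc n := x)))"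
proof -
  obtain F where F: "finite F" "F \<subseteq> poly_fun (Suc n)"
    "\<forall>c e. (\<forall>f\<in>F. f c = 0 \<longleftrightarrow> f e = 0) \<longrightarrow> P c = P e"
    using assms by (rule constructibleE) (rule that)
  \<comment> \<open>The vanishing patterns that occur at points satisfying \<open>P\<close>.\<close>
  define V where "V = {S. \<exists>e. P e \<and> S = {f\<in>F. f e = 0}}"
  have V: "V \<subseteq> Pow F" by (auto simp: V_def)
  have P_iff: "P e \<longleftrightarrow> (\<exists>S\<in>V. (\<forall>f\<in>S. f e = 0) \<and> (\<Prod>f\<in>F - S. f e) \<noteq> 0)" for e
  proof
    assume "P e"
    then show "\<exists>S\<in>V. (\<forall>f\<in>S. f e = 0) \<and> (\<Prod>f\<in>F - S. f e) \<noteq> 0"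
      using F(1) by (intro bexI[of _ "{f\<in>F. f e = 0}"]) (auto simp: V_def)
  next
    assume "\<exists>S\<in>V. (\<forall>f\<in>S. f e = 0) \<and> (\<Prod>f\<in>F - S. f e) \<noteq> 0"
    then obtain e' where "P e'" "\<forall>f\<in>{f\<in>F. f e' = 0}. f e = 0"
      "(\<Prod>f\<in>F - {f\<in>F. f e' = 0}. f e) \<noteq> 0" unfolding V_def by blast
    moreover from this(3) F(1) have "\<forall>f\<in>F. f e' \<noteq> 0 \<longrightarrow> f e \<noteq> 0" by auto
    ultimately have "\<forall>f\<in>F. f e = 0 \<longleftrightarrow> f e' = 0" by auto
    from F(3)[THEN spec, THEN spec, THEN mp, OF this] \<open>P e'\<close> show "P e" by simp
  qed
  have "constructible n (\<lambda>c. \<exists>x. (\<forall>f\<in>S. f (c(Suc n := x)) = 0) \<and> (\<Prod>f\<in>F - S. f (c(Suc n := x))) \<noteq> 0)"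
    if "S \<in> V" for S
  proof -
    have S: "finite S" "S \<subseteq> F" using that V F(1) finite_subset[of S F] by auto
    have "\<forall>f\<in>F. \<exists>TD. poly_family n (fst TD) (snd TD) \<and>
        (\<forall>c x. f (c(Suc n := x)) = poly (fst TD c) x)"
    proof
      fix f assume "f \<in> F"
      then have "f \<in> poly_fun (Suc n)" using F(2) by blast
      from poly_fun_Suc_poly[OF this] show "\<exists>TD. poly_family n (fst TD) (snd TD) \<and>
        (\<forall>c x. f (c(Suc n := x)) = poly (fst TD c) x)" by (metis fst_conv snd_conv)
    qed
    then obtain G where G: "\<And>f. f \<in> F \<Longrightarrow> poly_family n (fst (G f)) (snd (G f))"
      "\<And>f c x. f \<in> F \<Longrightarrow> f (c(Suc n := x)) = poly (fst (G f) c) x" by metis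
    obtain L where L: "set L = G ` S" using S(1) finite_list by (metis finite_imageI)
    have "(\<lambda>e. \<Prod>f\<in>F - S. f e) \<in> poly_fun (Suc n)"
      by (rule poly_fun_prod) (use F(2) in auto)
    from poly_fun_Suc_poly[OF this] obtain U E where U: "poly_family n U E"
      "\<And>c x. (\<Prod>f\<in>F - S. f (c(Suc n := x))) = poly (U c) x" by blast
    have "constructible n (\<lambda>c. \<exists>x. (\<forall>(T, D)\<in>set L. poly (T c) x = 0) \<and> poly (U c) x \<noteq> 0)"
    proof (rule constructible_system[OF U(1)], intro ballI)
      fix TD assume "TD \<in> set L"
      then obtain f where "f \<in> F" "TD = G f" using L S(2) by blast
      then show "case TD of (T, D) \<Rightarrow> poly_family n T D" using G(1) by (simp add: case_prod_beta)
    qed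
    moreover have "(\<forall>(T, D)\<in>set L. poly (T c) x = 0) \<longleftrightarrow> (\<forall>f\<in>S. f (c(Suc n := x)) = 0)" for c x
    proof -
      have "(\<forall>(T, D)\<in>set L. poly (T c) x = 0) \<longleftrightarrow> (\<forall>f\<in>S. poly (fst (G f) c) x = 0)"
        unfolding L by (simp add: case_prod_beta)
      also have "\<dots> \<longleftrightarrow> (\<forall>f\<in>S. f (c(Suc n := x)) = 0)"
      proof (rule ball_cong[OF refl])
        fix f assume "f \<in> S"
        then have "f \<in> F" using S(2) by blast
        from G(2)[OF this, of c x] show "poly (fst (G f) c) x = 0 \<longleftrightarrow> f (c(Suc n := x)) = 0" by simp
      qed
      finally show ?thesis .
    qed
    ultimately show ?thesis unfolding U(2) by (simp del: fun_upd_apply)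
  qed
  then have "constructible n (\<lambda>c. \<exists>S\<in>V. \<exists>x. (\<forall>f\<in>S. f (c(Suc n := x)) = 0)
      \<and> (\<Prod>f\<in>F - S. f (c(Suc n := x))) \<noteq> 0)"
    using V F(1) by (intro constructible_bex) (auto intro: finite_subset)
  then show ?thesis by (rule back_subst[of "constructible n"]) (auto simp: P_iff)
qed

text \<open>Projects away the variables \<open>n + 1\<close> to \<open>n + k\<close>, the last one
  first. The witness \<open>e\<close> is a whole vector, whose entries beyond \<open>n + k\<close>
  do not affect \<open>P\<close>.\<close>

lemma constructible_Ex_many:
  assumes "constructible (n + k) P"
  shows "constructible n (\<lambda>c. \<exists>e. (\<forall>i\<le>n. e i = c i) \<and> P e)"
  using assms
proof (induction k arbitrary: P)
  case 0
  then have "constructible n P" by simp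
  then obtain F where F: "F \<subseteq> poly_fun n"
    "\<forall>c e. (\<forall>f\<in>F. f c = 0 \<longleftrightarrow> f e = 0) \<longrightarrow> P c = P e"
    by (rule constructibleE) (rule that)
  \<comment> \<open>Members of \<open>F\<close> see only coordinates up to \<open>n\<close>, so the
    remaining freedom in \<open>e\<close> changes nothing.\<close>
  have "P c = P e" if "\<forall>i\<le>n. e i = c i" for c e
  proof (rule F(2)[rule_format])
    fix f assume "f \<in> F"
    then have "f e = f c" using that F(1) by (intro poly_fun_cong[of f n]) auto
    then show "f c = 0 \<longleftrightarrow> f e = 0" by simp
  qed
  then have "(\<lambda>c. \<exists>e. (\<forall>i\<le>n. e i = c i) \<and> P e) = P" by blast
  then show ?case using 0 by simp
next
  case (Suc k)
  have "constructible n (\<lambda>c. \<exists>e. (\<forall>i\<le>n. e i = c i) \<and> (\<exists>x. P (e(Suc (n + k) := x))))"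
    by (rule Suc.IH, rule constructible_Ex) (use Suc.prems in simp)
  moreover have "(\<exists>e. (\<forall>i\<le>n. e i = c i) \<and> (\<exists>x. P (e(Suc (n + k) := x)))) \<longleftrightarrow>
      (\<exists>e. (\<forall>i\<le>n. e i = c i) \<and> P e)" (is "?l \<longleftrightarrow> ?r") for c
  proof
    assume ?l
    then obtain e x where "\<forall>i\<le>n. e i = c i" "P (e(Suc (n + k) := x))" by blast
    then show ?r by (intro exI[of _ "e(Suc (n + k) := x)"]) auto
  next
    assume ?r
    then show ?l by (metis fun_upd_triv)
  qed
  ultimately show ?case by simp
qed

section \<open>Zariski density\<close>

text \<open>Where no nonzero member of \<open>F\<close> vanishes, all points have the same vanishing
  pattern, so \<open>P\<close> is constant there. Density provides one such point with
  \<open>P\<close>.\<close>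

lemma general_if_constructible_dense:
  assumes "constructible d P"
    and dense: "\<And>Q. Q \<in> poly_fun d \<Longrightarrow> (\<And>c. P c \<Longrightarrow> Q c = 0) \<Longrightarrow> (\<And>c. Q c = 0)"
  shows "general d P"
proof -
  obtain F where F: "finite F" "F \<subseteq> poly_fun d"
    "\<forall>c e. (\<forall>f\<in>F. f c = 0 \<longleftrightarrow> f e = 0) \<longrightarrow> P c = P e"
    using assms(1) by (rule constructibleE) (rule that)
  \<comment> \<open>Members of \<open>F\<close> that vanish identically cannot distinguish two
    points and must be left out for the product \<open>Q\<close> to be nonzero.\<close>
  define F' where "F' = {f\<in>F. \<exists>c. f c \<noteq> 0}"
  define Q where "Q = (\<lambda>c. \<Prod>f\<in>F'. f c)"
  have F': "finite F'" using F(1) by (simp add: F'_def)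
  have Q: "Q \<in> poly_fun d" unfolding Q_def
    by (rule poly_fun_prod) (use F(2) in \<open>auto simp: F'_def\<close>)
  obtain a where a: "Q a \<noteq> 0"
    using poly_fun_prod_nonzero[OF F', of d] F(2) by (auto simp: Q_def F'_def)
  then obtain c0 where c0: "P c0" "Q c0 \<noteq> 0" using dense[OF Q] by blast
  have generic: "P c" if "Q c \<noteq> 0" for c
  proof -
    have "\<forall>f\<in>F. f c = 0 \<longleftrightarrow> f c0 = 0"
    proof
      fix f assume "f \<in> F"
      show "f c = 0 \<longleftrightarrow> f c0 = 0"
      proof (cases "f \<in> F'")
        case True
        then show ?thesis using \<open>Q c \<noteq> 0\<close> c0(2) F' by (auto simp: Q_def)
      qed (use \<open>f \<in> F\<close> in \<open>auto simp: F'_def\<close>)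
    qed
    from F(3)[THEN spec, THEN spec, THEN mp, OF this] c0(1) show ?thesis by simp
  qed
  define U where "U = forms_space d - {c \<in> forms_space d. \<forall>q\<in>{Q}. q c = 0}"
  \<comment> \<open>Cutting \<open>a\<close> off above \<open>d\<close> makes it a form without
    changing \<open>Q\<close>, so \<open>U\<close> is nonempty.\<close>
  have "(\<lambda>i. if i \<le> d then a i else 0) \<in> U"
    using a poly_fun_cong[OF Q, of "\<lambda>i. if i \<le> d then a i else 0" a] by (auto simp: U_def forms_space_def)
  moreover have "zariski_open d U" unfolding zariski_open_def U_def using Q by blast
  moreover have "\<forall>c\<in>U. P c" using generic by (auto simp: U_def)
  ultimately show ?thesis unfolding general_def by blast
qed

text \<open>A curve through \<open>a\<close> with velocity \<open>h\<close> on which \<open>Q\<close> vanishes kills the leading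
  homogeneous part of the Taylor expansion of \<open>Q\<close> at \<open>a\<close> in the direction \<open>h\<close>.\<close>
lemma poly_fun_zero_if_curves:
  assumes Q: "Q \<in> poly_fun n"
    and curve: "\<And>h. \<exists>g. (\<forall>i\<le>n. g 0 i = a i \<and> ((\<lambda>x. g x i) has_field_derivative h i) (at 0)) \<and>
                    (\<forall>\<^sub>F x in at 0. Q (g x) = 0)"
  shows "Q c = 0"
proof -
  obtain T D where T: "poly_family n T D" "\<And>h x. Q (\<lambda>i. a i + x * h i) = poly (T h) x"
    using poly_fun_taylor[OF Q] by blast
  have poly_T: "poly (T h) x = (\<Sum>i<D. coeff (T h) i * x ^ i)" for h x
  proof -
    have "poly (T h) x = (\<Sum>i\<le>degree (T h). coeff (T h) i * x ^ i)" by (rule poly_altdef)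
    also have "\<dots> = (\<Sum>i<D + Suc (degree (T h)). coeff (T h) i * x ^ i)"
      by (rule sum.mono_neutral_left) (auto intro: coeff_eq_0)
    also have "\<dots> = (\<Sum>i<D. coeff (T h) i * x ^ i)"
      by (rule sum.mono_neutral_right) (auto intro: poly_family_vanish[OF T(1)])
    finally show ?thesis .
  qed
  \<comment> \<open>Strong induction on the order \<open>j\<close>, for all directions at once: the
    hypothesis is applied to secant directions that vary with \<open>x\<close>.\<close>
  have "\<forall>h. coeff (T h) j = 0" for j
  proof (induction j rule: less_induct)
    case (less j)
    show ?case
    proof (cases "D \<le> j")
      case True
      then show ?thesis using poly_family_vanish[OF T(1)] by blast
    next
      case False
      show ?thesis
      proof
        fix h
        obtain g where g: "\<And>i. i \<le> n \<Longrightarrow> g 0 i = a i"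
          "\<And>i. i \<le> n \<Longrightarrow> ((\<lambda>x. g x i) has_field_derivative h i) (at 0)"
          "\<forall>\<^sub>F x in at 0. Q (g x) = 0" using curve by blast
        \<comment> \<open>The secant direction: \<open>g x\<close> is \<open>a + x * H x\<close>,
          and \<open>H x\<close> tends to the velocity \<open>h\<close>.\<close>
        define H where "H = (\<lambda>x i. (g x i - a i) / x)"
        have H: "((\<lambda>x. H x i) \<longlongrightarrow> h i) (at 0)" if "i \<le> n" for i
          using g(2)[OF that] g(1)[OF that] by (simp add: H_def has_field_derivative_iff)
        have "((\<lambda>x. \<Sum>i\<in>{j..<D}. coeff (T (H x)) i * x ^ (i - j)) \<longlongrightarrow>
            (\<Sum>i\<in>{j..<D}. coeff (T h) i * 0 ^ (i - j))) (at 0)"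
          by (intro tendsto_intros poly_fun_tendsto[OF poly_family_coeff[OF T(1)]] H)
        moreover have "\<forall>\<^sub>F x in at 0. (\<Sum>i\<in>{j..<D}. coeff (T (H x)) i * x ^ (i - j)) = 0"
          using g(3) eventually_neq_at_within[of 0]
        proof eventually_elim
          case (elim x)
          have "Q (\<lambda>i. a i + x * H x i) = Q (\<lambda>i. g x i)"
            by (rule poly_fun_cong[OF Q]) (use elim in \<open>simp add: H_def\<close>)
          then have "0 = (\<Sum>i<D. coeff (T (H x)) i * x ^ i)"
            using elim T(2) poly_T by simp
          \<comment> \<open>Orders below \<open>j\<close> vanish in the direction \<open>H x\<close>
            by induction; \<open>x ^ j\<close> is then cancelled.\<close>
          also have "\<dots> = (\<Sum>i\<in>{j..<D}. coeff (T (H x)) i * x ^ i)"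
            by (rule sum.mono_neutral_right) (use less in auto)
          also have "\<dots> = (\<Sum>i\<in>{j..<D}. x ^ j * (coeff (T (H x)) i * x ^ (i - j)))"
            by (rule sum.cong) (auto simp flip: power_add)
          finally show ?case using elim by (simp flip: sum_distrib_left)
        qed
        ultimately have "((\<lambda>x::complex. 0::complex) \<longlongrightarrow>
            (\<Sum>i\<in>{j..<D}. coeff (T h) i * 0 ^ (i - j))) (at 0)"
          using tendsto_cong by fastforce
        then have "(\<Sum>i\<in>{j..<D}. coeff (T h) i * 0 ^ (i - j)) = 0"
          by (simp add: tendsto_const_iff)
        \<comment> \<open>In the limit \<open>x = 0\<close> only the term \<open>i = j\<close>
          survives, with \<open>0 ^ 0 = 1\<close>.\<close>
        also have "(\<Sum>i\<in>{j..<D}. coeff (T h) i * 0 ^ (i - j)) = (\<Sum>i\<in>{j}. coeff (T h) i * 0 ^ (i - j))"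
          by (rule sum.mono_neutral_right) (use False in auto)
        finally show "coeff (T h) j = 0" by simp
      qed
    qed
  qed
  \<comment> \<open>All orders vanish in every direction; the direction from \<open>a\<close> to
    \<open>c\<close> at parameter 1 reaches \<open>c\<close>.\<close>
  then have "T (\<lambda>i. c i - a i) = 0" by (simp add: poly_eq_iff)
  then show ?thesis using T(2)[of 1 "\<lambda>i. c i - a i"] by simp
qed

section \<open>Linear changes of variables in binary forms\<close>

lemma binary_form_dehomogenize:
  assumes "degree p \<le> d" "x \<noteq> 0"
  shows "binary_form d (coeff p) x y = x ^ d * poly p (y / x)"
proof -
  have "poly p (y / x) = (\<Sum>i=0..d. coeff p i * (y / x) ^ i)"
    unfolding poly_altdef by (rule sum.mono_neutral_left) (use assms in \<open>auto intro: coeff_eq_0\<close>)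
  then show ?thesis
    unfolding binary_form_def sum_distrib_left
    by (auto simp: sum_distrib_left power_divide power_diff assms(2) intro!: sum.cong)
qed

text \<open>The form with coefficients \<open>s\<close> in the new variables
  \<open>X = a1*x + a2*y\<close> and \<open>Y = a3*x + a4*y\<close>, dehomogenized at
  \<open>x = 1\<close>. Its coefficients as a univariate polynomial are those of the form in
  \<open>x\<close> and \<open>y\<close>.\<close>

definition form_poly :: "nat \<Rightarrow> (nat \<Rightarrow> complex) \<Rightarrow> complex \<Rightarrow> complex \<Rightarrow> complex \<Rightarrow> complex \<Rightarrow> complex poly" where
  "form_poly d s a1 a2 a3 a4 = (\<Sum>k=0..d. smult (s k) ([:a1, a2:] ^ (d - k) * [:a3, a4:] ^ k))"

lemma degree_form_poly: "degree (form_poly d s a1 a2 a3 a4) \<le> d"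
  unfolding form_poly_def
proof (rule degree_sum_le)
  fix k assume "k \<in> {0..d}"
  have "degree ([:a1, a2:] ^ (d - k) * [:a3, a4:] ^ k)
      \<le> degree [:a1, a2:] * (d - k) + degree [:a3, a4:] * k"
    by (intro order.trans[OF degree_mult_le] add_mono degree_power_le)
  also have "\<dots> \<le> 1 * (d - k) + 1 * k" by (intro add_mono mult_right_mono) auto
  finally show "degree (smult (s k) ([:a1, a2:] ^ (d - k) * [:a3, a4:] ^ k)) \<le> d"
    using \<open>k \<in> {0..d}\<close> degree_smult_le order.trans by fastforce
qed simp

lemma binary_form_form_poly:
  "binary_form d (coeff (form_poly d s a1 a2 a3 a4)) x y =
     (\<Sum>k=0..d. s k * (a1*x + a2*y) ^ (d - k) * (a3*x + a4*y) ^ k)" (is "?l x = ?r x")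
proof -
  have nz: "?l x = ?r x" if "x \<noteq> 0" for x
  proof -
    have "?l x = x ^ d * (\<Sum>k=0..d. s k * ((a1 + y / x * a2) ^ (d - k) * (a3 + y / x * a4) ^ k))"
      unfolding binary_form_dehomogenize[OF degree_form_poly that] by (simp add: form_poly_def poly_sum)
    also have "\<dots> = ?r x"
      unfolding sum_distrib_left
    proof (rule sum.cong)
      fix k assume "k \<in> {0..d}"
      then have "x ^ d = x ^ (d - k) * x ^ k" by (simp flip: power_add)
      moreover have "a1*x + a2*y = x * (a1 + y / x * a2)" "a3*x + a4*y = x * (a3 + y / x * a4)"
        using that by (simp_all add: field_simps)
      ultimately show "x ^ d * (s k * ((a1 + y / x * a2) ^ (d - k) * (a3 + y / x * a4) ^ k)) =
          s k * (a1*x + a2*y) ^ (d - k) * (a3*x + a4*y) ^ k"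
        by (simp add: power_mult_distrib mult_ac)
    qed simp
    finally show ?thesis .
  qed
  show ?thesis
  proof (cases "x = 0")
    case True
    \<comment> \<open>Dehomogenizing divides by \<open>x\<close>; the line \<open>x = 0\<close> is
      reached by continuity of both sides.\<close>
    have "isCont ?l 0" unfolding binary_form_def by (intro continuous_intros)
    then have "(?l \<longlongrightarrow> ?l 0) (at 0)" by (simp add: isCont_def)
    moreover have "isCont ?r 0" by (intro continuous_intros)
    then have "(?r \<longlongrightarrow> ?r 0) (at 0)" by (simp add: isCont_def)
    moreover have "\<forall>\<^sub>F x in at 0. ?r x = ?l x"
      using eventually_neq_at_within[of 0] by eventually_elim (simp add: nz)
    ultimately have "?l 0 = ?r 0"
      by (intro tendsto_unique[of "at 0" ?l]) (auto intro: Lim_transform_eventually)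
    then show ?thesis using True by simp
  qed (rule nz)
qed

section \<open>First-order variation of a form under a change of variables\<close>

definition has_coeff_derivative :: "(complex \<Rightarrow> complex poly) \<Rightarrow> complex poly \<Rightarrow> bool" where
  "has_coeff_derivative f D \<longleftrightarrow> (\<forall>i. ((\<lambda>x. coeff (f x) i) has_field_derivative coeff D i) (at 0))"

lemma has_coeff_derivative_linear:
  "has_coeff_derivative (\<lambda>x. [:p + x * b, q + x * c:]) [:b, c:]"
  unfolding has_coeff_derivative_def
proof
  fix i show "((\<lambda>x. coeff [:p + x * b, q + x * c:] i) has_field_derivative coeff [:b, c:] i) (at 0)"
    by (auto simp: coeff_pCons split: nat.splits intro!: derivative_eq_intros)
qed

lemma has_coeff_derivative_mult:
  assumes "has_coeff_derivative f D" "has_coeff_derivative g E"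
  shows "has_coeff_derivative (\<lambda>x. f x * g x) (D * g 0 + f 0 * E)"
  unfolding has_coeff_derivative_def
proof
  fix i
  show "((\<lambda>x. coeff (f x * g x) i) has_field_derivative coeff (D * g 0 + f 0 * E) i) (at 0)"
    unfolding coeff_mult coeff_add sum.distrib[symmetric]
    by (intro DERIV_sum DERIV_cong[OF DERIV_mult])
      (use assms in \<open>auto simp: has_coeff_derivative_def\<close>)
qed

lemma has_coeff_derivative_smult:
  assumes "(s has_field_derivative t) (at 0)" "has_coeff_derivative f D"
  shows "has_coeff_derivative (\<lambda>x. smult (s x) (f x)) (smult t (f 0) + smult (s 0) D)"
  using assms unfolding has_coeff_derivative_def
  by (auto intro!: derivative_eq_intros)

lemma has_coeff_derivative_sum:
  assumes "\<And>k. k \<in> A \<Longrightarrow> has_coeff_derivative (f k) (D k)"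
  shows "has_coeff_derivative (\<lambda>x. \<Sum>k\<in>A. f k x) (\<Sum>k\<in>A. D k)"
  using assms unfolding has_coeff_derivative_def coeff_sum by (auto intro!: DERIV_sum)

text \<open>For \<open>k = 0\<close> the truncated exponent \<open>k - 1\<close> is harmless, as the
  factor \<open>of_nat k\<close> is zero.\<close>

lemma has_coeff_derivative_power:
  assumes "has_coeff_derivative f D"
  shows "has_coeff_derivative (\<lambda>x. f x ^ k) (smult (of_nat k) (f 0 ^ (k - 1) * D))"
proof (induction k)
  case 0
  show ?case by (simp add: has_coeff_derivative_def)
next
  case (Suc k)
  have "D * f 0 ^ k + f 0 * smult (of_nat k) (f 0 ^ (k - 1) * D) =
      smult (of_nat (Suc k)) (f 0 ^ (Suc k - 1) * D)"
  proof (cases k)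
    case (Suc j)
    have "f 0 * smult (of_nat k) (f 0 ^ (k - 1) * D) = smult (of_nat k) (f 0 ^ k * D)"
      by (simp add: Suc mult_ac)
    then show ?thesis
      by (simp only: of_nat_Suc smult_add_left) (simp add: mult.commute)
  qed simp
  then show ?case using has_coeff_derivative_mult[OF assms Suc] by simp
qed

text \<open>The product rule along the matrices \<open>I + x B\<close>. At \<open>x = 0\<close> the
  new variables are the old ones, dehomogenized to \<open>1\<close> and \<open>[:0, 1:]\<close>, so
  their powers become \<open>1\<close> and \<open>monom 1 k\<close>.\<close>

lemma has_coeff_derivative_form_poly:
  assumes s: "\<And>k. ((\<lambda>x. s x k) has_field_derivative t k) (at 0)"
  shows "has_coeff_derivative (\<lambda>x. form_poly d (s x) (1 + x * b1) (x * b2) (x * b3) (1 + x * b4))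
    (\<Sum>k=0..d. smult (t k) (monom 1 k) + smult (s 0 k)
       (smult (of_nat (d - k)) (monom 1 k * [:b1, b2:]) + smult (of_nat k) (monom 1 (k - 1) * [:b3, b4:])))"
proof -
  have 1: "has_coeff_derivative (\<lambda>x. [:1 + x * b1, x * b2:] ^ (d - k)) (smult (of_nat (d - k)) [:b1, b2:])" for k
    using has_coeff_derivative_power[OF has_coeff_derivative_linear[of 1 b1 0 b2], of "d - k"]
    by (simp flip: one_pCons)
  have X: "[:0, 1:] ^ k = monom (1::complex) k" "pCons 0 1 ^ k = monom (1::complex) k" for k
    by (simp_all add: monom_altdef one_pCons)
  have 2: "has_coeff_derivative (\<lambda>x. [:x * b3, 1 + x * b4:] ^ k)
      (smult (of_nat k) (monom 1 (k - 1) * [:b3, b4:]))" for k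
    using has_coeff_derivative_power[OF has_coeff_derivative_linear[of 0 b3 1 b4], of k]
    by (simp add: X)
  have 3: "has_coeff_derivative (\<lambda>x. [:1 + x * b1, x * b2:] ^ (d - k) * [:x * b3, 1 + x * b4:] ^ k)
      (smult (of_nat (d - k)) (monom 1 k * [:b1, b2:]) + smult (of_nat k) (monom 1 (k - 1) * [:b3, b4:]))" for k
    using has_coeff_derivative_mult[OF 1[of k] 2[of k]] by (simp add: X mult_ac smult_add_right flip: one_pCons)
  have "has_coeff_derivative (\<lambda>x. smult (s x k) ([:1 + x * b1, x * b2:] ^ (d - k) * [:x * b3, 1 + x * b4:] ^ k))
    (smult (t k) (monom 1 k) + smult (s 0 k)
       (smult (of_nat (d - k)) (monom 1 k * [:b1, b2:]) + smult (of_nat k) (monom 1 (k - 1) * [:b3, b4:])))" for k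
    using has_coeff_derivative_smult[OF s 3] by (simp add: X flip: one_pCons)
  then show ?thesis unfolding form_poly_def by (intro has_coeff_derivative_sum)
qed

text \<open>The diagonal entries \<open>b1\<close>, \<open>b4\<close> rescale each monomial. The
  entry \<open>b2\<close> multiplies Y dp/dX and moves a coefficient from \<open>i - 1\<close> to
  \<open>i\<close>; \<open>b3\<close> multiplies X dp/dY and moves one from \<open>i + 1\<close> to
  \<open>i\<close>.\<close>

lemma coeff_form_poly_derivative:
  assumes "i \<le> d"
  shows "coeff (\<Sum>k=0..d. smult (t k) (monom 1 k) + smult (s k)
       (smult (of_nat (d - k)) (monom 1 k * [:b1, b2:]) + smult (of_nat k) (monom 1 (k - 1) * [:b3, b4:]))) i
    = t i + s i * (of_nat (d - i) * b1 + of_nat i * b4)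
      + (if i = 0 then 0 else s (i - 1) * of_nat (d - (i - 1))) * b2
      + (if i < d then s (Suc i) * of_nat (Suc i) else 0) * (b3 :: complex)"
proof -
  have linear: "monom 1 k * [:b, c:] = monom b k + monom c (Suc k)" for k and b c :: complex
  proof -
    have "[:b, c:] = monom b 0 + monom c 1" by (simp add: monom_0 monom_Suc)
    then show ?thesis by (simp add: distrib_left mult_monom)
  qed
  have "coeff (smult (t k) (monom 1 k) + smult (s k)
       (smult (of_nat (d - k)) (monom 1 k * [:b1, b2:]) + smult (of_nat k) (monom 1 (k - 1) * [:b3, b4:]))) i
    = (if k = i then t k + s k * (of_nat (d - k) * b1 + of_nat k * b4) else 0)
      + (if Suc k = i then s k * of_nat (d - k) * b2 else 0)
      + (if k = Suc i then s k * of_nat k * b3 else 0)" (is "_ = ?a k + ?b k + ?c k") for k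
    unfolding linear by (cases k) (auto simp: algebra_simps coeff_pCons split: nat.splits)
  then have "coeff (\<Sum>k=0..d. smult (t k) (monom 1 k) + smult (s k)
       (smult (of_nat (d - k)) (monom 1 k * [:b1, b2:]) + smult (of_nat k) (monom 1 (k - 1) * [:b3, b4:]))) i
    = (\<Sum>k=0..d. ?a k + ?b k + ?c k)"
    unfolding coeff_sum by (intro sum.cong refl)
  also have "\<dots> = sum ?a {0..d} + sum ?b {0..d} + sum ?c {0..d}" by (simp only: sum.distrib)
  also have "sum ?a {0..d} = t i + s i * (of_nat (d - i) * b1 + of_nat i * b4)"
    using assms by (simp add: sum.delta)
  also have "sum ?b {0..d} = (if i = 0 then 0 else s (i - 1) * of_nat (d - (i - 1))) * b2"
    using assms by (cases i) (auto simp: sum.delta)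
  also have "sum ?c {0..d} = (if i < d then s (Suc i) * of_nat (Suc i) else 0) * b3"
    by (simp add: sum.delta)
  finally show ?thesis .
qed

section \<open>The linear algebra behind surjectivity\<close>

lemma solve_2x2:
  fixes p q r s u v :: complex
  assumes "p * s - q * r \<noteq> 0"
  shows "\<exists>x y. p * x + q * y = u \<and> r * x + s * y = v"
proof (intro exI conjI)
  let ?D = "p * s - q * r"
  have "p * ((u * s - q * v) / ?D) + q * ((p * v - u * r) / ?D) = u * ?D / ?D"
    by (simp add: add_divide_distrib[symmetric] algebra_simps)
  then show "p * ((u * s - q * v) / ?D) + q * ((p * v - u * r) / ?D) = u" using assms by simp
  have "r * ((u * s - q * v) / ?D) + s * ((p * v - u * r) / ?D) = v * ?D / ?D"
    by (simp add: add_divide_distrib[symmetric] algebra_simps)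
  then show "r * ((u * s - q * v) / ?D) + s * ((p * v - u * r) / ?D) = v" using assms by simp
qed

text \<open>For adjacent indices the right side is zero, since each index receives from the other,
  whose weight is 0; the left side is nonzero because the exclusions rule out \<open>m1 = 0\<close>
  and \<open>m2 = d\<close>. Otherwise the right side is positive, while the left side is zero at
  the boundary and strictly larger in the interior. Natural numbers make this comparison
  available.\<close>

lemma shift_minor_less:
  fixes d m1 m2 :: nat
  assumes "m1 < m2" "m2 \<le> d" "{m1, m2} \<noteq> {0, 1}" "{m1, m2} \<noteq> {d - 1, d}"
  defines "s \<equiv> \<lambda>k. if k \<in> {m1, m2} then 0 else 1"
  defines "down \<equiv> \<lambda>i. if i = 0 then 0 else s (i - 1) * (d - (i - 1))"
    and "up \<equiv> \<lambda>i. if i < d then s (Suc i) * Suc i else 0"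
  shows "down m1 * up m2 \<noteq> up m1 * down m2"
proof (cases "m2 = Suc m1")
  case True
  have "m1 \<noteq> 0" using assms(3) True by auto
  moreover have "m2 < d" using assms(2,4) True by (cases "m2 = d") auto
  ultimately show ?thesis using True by (auto simp: s_def down_def up_def)
next
  case False
  have *: "up m1 = Suc m1" "down m2 = Suc d - m2"
    using assms(1,2) False by (auto simp: s_def down_def up_def)
  show ?thesis
  proof (cases "m1 = 0 \<or> m2 = d")
    case True
    then show ?thesis using * assms(1,2) by (auto simp: down_def up_def)
  next
    case False
    then have "down m1 = Suc d - m1" "up m2 = Suc m2"
      using assms(1,2) by (auto simp: s_def down_def up_def)
    moreover have "Suc m1 * (Suc d - m2) < Suc m2 * (Suc d - m1)"
      using assms(1,2) by (intro mult_strict_mono) auto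
    ultimately show ?thesis unfolding * by (simp add: mult.commute)
  qed
qed

lemma shift_minor:
  fixes d m1 m2 :: nat
  assumes "m1 \<noteq> m2" "m1 \<le> d" "m2 \<le> d" "{m1, m2} \<noteq> {0, 1}" "{m1, m2} \<noteq> {d - 1, d}"
  defines "s \<equiv> \<lambda>k. if k \<in> {m1, m2} then 0 else 1"
  defines "down \<equiv> \<lambda>i. if i = 0 then 0 else s (i - 1) * (d - (i - 1))"
    and "up \<equiv> \<lambda>i. if i < d then s (Suc i) * Suc i else 0"
  shows "down m1 * up m2 \<noteq> up m1 * down m2"
proof (cases "m1 < m2")
  case True
  show ?thesis
    using shift_minor_less[OF True assms(3-5)] unfolding s_def down_def up_def .
next
  case False
  then have "m2 < m1" using assms(1) by simp
  have "down m2 * up m1 \<noteq> up m2 * down m1"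
    using shift_minor_less[of m2 m1 d, unfolded insert_commute[of m2 m1], OF \<open>m2 < m1\<close> assms(2,4,5)]
    unfolding s_def down_def up_def .
  then show ?thesis by (metis mult.commute)
qed

section \<open>The normal form\<close>

locale normal_form =
  fixes d m1 m2 n1 n2 :: nat
  assumes d: "d \<ge> 3"
    and le: "m1 \<le> d" "m2 \<le> d" "n1 \<le> d" "n2 \<le> d"
    and dist: "distinct [m1, m2, n1, n2]"
    and excl: "{m1, m2} \<noteq> {0, 1}" "{m1, m2} \<noteq> {d - 1, d}"
begin

definition weights :: "(nat \<Rightarrow> complex) \<Rightarrow> nat \<Rightarrow> complex" where
  "weights t k = (if k \<in> {m1, m2} then 0 else if k \<in> {n1, n2} then 1 else t k)"

text \<open>Stated by coefficients rather than by values, so that it is a system of polynomial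
  conditions on \<open>c\<close>, the matrix entries and \<open>t\<close>.\<close>

definition has_normal_form :: "(nat \<Rightarrow> complex) \<Rightarrow> bool" where
  "has_normal_form c \<longleftrightarrow> (\<exists>a1 a2 a3 a4 t. a1 * a4 - a2 * a3 \<noteq> 0 \<and>
     (\<forall>i\<le>d. c i = coeff (form_poly d (weights t) a1 a2 a3 a4) i))"

lemma has_normal_formD:
  assumes "has_normal_form c"
  shows "\<exists>a1 a2 a3 a4 :: complex. a1 * a4 - a2 * a3 \<noteq> 0 \<and>
           (\<exists>t :: nat \<Rightarrow> complex. \<forall>x y :: complex.
              binary_form d c x y =
                (a1*x + a2*y) ^ (d - n1) * (a3*x + a4*y) ^ n1
              + (a1*x + a2*y) ^ (d - n2) * (a3*x + a4*y) ^ n2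
              + (\<Sum>k\<in>{0..d} - {m1, m2, n1, n2}.
                   t k * (a1*x + a2*y) ^ (d - k) * (a3*x + a4*y) ^ k))"
proof -
  obtain a1 a2 a3 a4 t where a: "a1 * a4 - a2 * a3 \<noteq> 0"
    and c: "\<And>i. i \<le> d \<Longrightarrow> c i = coeff (form_poly d (weights t) a1 a2 a3 a4) i"
    using assms unfolding has_normal_form_def by blast
  have "binary_form d c x y =
        (a1*x + a2*y) ^ (d - n1) * (a3*x + a4*y) ^ n1
      + (a1*x + a2*y) ^ (d - n2) * (a3*x + a4*y) ^ n2
      + (\<Sum>k\<in>{0..d} - {m1, m2, n1, n2}. t k * (a1*x + a2*y) ^ (d - k) * (a3*x + a4*y) ^ k)" for x y
  proof -
    let ?f = "\<lambda>k. weights t k * (a1*x + a2*y) ^ (d - k) * (a3*x + a4*y) ^ k"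
    have "binary_form d c x y = binary_form d (coeff (form_poly d (weights t) a1 a2 a3 a4)) x y"
      unfolding binary_form_def by (rule sum.cong) (use c in auto)
    also have "\<dots> = sum ?f {0..d}" by (rule binary_form_form_poly)
    also have "\<dots> = sum ?f {m1, m2, n1, n2} + sum ?f ({0..d} - {m1, m2, n1, n2})"
      using le by (subst add.commute, intro sum.subset_diff) auto
    also have "sum ?f {m1, m2, n1, n2} = (a1*x + a2*y) ^ (d - n1) * (a3*x + a4*y) ^ n1
      + (a1*x + a2*y) ^ (d - n2) * (a3*x + a4*y) ^ n2"
      using dist by (simp add: weights_def)
    also have "sum ?f ({0..d} - {m1, m2, n1, n2}) =
        (\<Sum>k\<in>{0..d} - {m1, m2, n1, n2}. t k * (a1*x + a2*y) ^ (d - k) * (a3*x + a4*y) ^ k)"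
      by (rule sum.cong) (auto simp: weights_def)
    finally show ?thesis .
  qed
  with a show ?thesis by blast
qed

text \<open>The matrix entries and the \<open>t k\<close> become \<open>d + 5\<close> further
  coordinates of one vector \<open>e\<close>, which are then eliminated.\<close>

lemma constructible_has_normal_form: "constructible d has_normal_form"
proof -
  \<comment> \<open>Layout of \<open>e\<close>: the form in positions 0 to \<open>d\<close>, the
    matrix in \<open>d + 1\<close> to \<open>d + 4\<close>, and \<open>t k\<close> in
    \<open>d + 5 + k\<close>, up to \<open>d + (d + 5)\<close>.\<close>
  let ?p = "\<lambda>e. form_poly d (weights (\<lambda>k. e (d + 5 + k))) (e (d + 1)) (e (d + 2)) (e (d + 3)) (e (d + 4))"
  let ?det = "\<lambda>e :: nat \<Rightarrow> complex. e (d + 1) * e (d + 4) - e (d + 2) * e (d + 3)"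
  have lin: "\<exists>D. poly_family (d + (d + 5)) (\<lambda>e. [:e i, e j:] ^ k) D"
    if "i \<le> d + (d + 5)" "j \<le> d + (d + 5)" for i j k
    using poly_family_power[OF poly_family_linear[OF poly_fun.pf_var[OF that(1)] poly_fun.pf_var[OF that(2)]]] .
  have "\<exists>D. poly_family (d + (d + 5)) ?p D"
    unfolding form_poly_def
  proof (rule poly_family_sum)
    fix k assume "k \<in> {0..d}"
    then have w: "(\<lambda>e. weights (\<lambda>k. e (d + 5 + k)) k) \<in> poly_fun (d + (d + 5))"
      by (cases "k \<in> {m1, m2}"; cases "k \<in> {n1, n2}") (auto simp: weights_def intro: poly_fun.intros)
    obtain D where D: "poly_family (d + (d + 5)) (\<lambda>e. [:e (d + 1), e (d + 2):] ^ (d - k)) D"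
      using lin by force
    obtain E where E: "poly_family (d + (d + 5)) (\<lambda>e. [:e (d + 3), e (d + 4):] ^ k) E"
      using lin by force
    show "\<exists>D. poly_family (d + (d + 5)) (\<lambda>e. smult (weights (\<lambda>k. e (d + 5 + k)) k)
        ([:e (d + 1), e (d + 2):] ^ (d - k) * [:e (d + 3), e (d + 4):] ^ k)) D"
      using poly_family_smult[OF w poly_family_mult[OF D E]] by blast
  qed
  then obtain D where p: "poly_family (d + (d + 5)) ?p D" by blast
  have "constructible (d + (d + 5)) (\<lambda>e. \<not> ?det e = 0 \<and> (\<forall>i\<in>{..d}. e i - coeff (?p e) i = 0))"
    by (intro constructible_conj constructible_not constructible_ball constructible_zero
        poly_fun_diff poly_fun.pf_mult poly_fun.pf_var poly_family_coeff[OF p]) auto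
  from constructible_Ex_many[OF this]
  have constr: "constructible d (\<lambda>c. \<exists>e. (\<forall>i\<le>d. e i = c i) \<and>
      (\<not> ?det e = 0 \<and> (\<forall>i\<in>{..d}. e i - coeff (?p e) i = 0)))" .
  have eq: "has_normal_form c \<longleftrightarrow> (\<exists>e. (\<forall>i\<le>d. e i = c i) \<and>
      (\<not> ?det e = 0 \<and> (\<forall>i\<in>{..d}. e i - coeff (?p e) i = 0)))" (is "_ \<longleftrightarrow> ?r") for c
  proof
    assume "has_normal_form c"
    then obtain a1 a2 a3 a4 t where "a1 * a4 - a2 * a3 \<noteq> 0"
      "\<forall>i\<le>d. c i = coeff (form_poly d (weights t) a1 a2 a3 a4) i"
      unfolding has_normal_form_def by blast
    then show ?r
      by (intro exI[of _ "\<lambda>i. if i \<le> d then c i else if i = d + 1 then a1 else if i = d + 2 then a2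
           else if i = d + 3 then a3 else if i = d + 4 then a4 else t (i - (d + 5))"]) auto
  next
    assume ?r
    then obtain e where e: "\<forall>i\<le>d. e i = c i" "?det e \<noteq> 0" "\<forall>i\<in>{..d}. e i - coeff (?p e) i = 0" by blast
    show "has_normal_form c" unfolding has_normal_form_def
      by (intro exI[of _ "e (d + 1)"] exI[of _ "e (d + 2)"] exI[of _ "e (d + 3)"] exI[of _ "e (d + 4)"]
          exI[of _ "\<lambda>k. e (d + 5 + k)"] conjI e(2) allI impI) (use e(1,3) in auto)
  qed
  show ?thesis
    by (rule back_subst[of "constructible d", OF constr], rule ext) (simp only: eq)
qed

text \<open>The left-hand side is the differential of the parametrization, as computed in
  \<open>coeff_form_poly_derivative\<close>, at the point given by the identity and \<open>t = 1\<close>.\<close>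
lemma differential_surjective:
  obtains b1 b2 b3 b4 :: complex and \<tau> where "\<forall>i\<le>d.
    (if i \<in> {m1, m2, n1, n2} then 0 else \<tau> i) + weights (\<lambda>_. 1) i * (of_nat (d - i) * b1 + of_nat i * b4)
      + (if i = 0 then 0 else weights (\<lambda>_. 1) (i - 1) * of_nat (d - (i - 1))) * b2
      + (if i < d then weights (\<lambda>_. 1) (Suc i) * of_nat (Suc i) else 0) * b3 = h i"
proof -
  let ?w = "weights (\<lambda>_. 1)"
  let ?s = "\<lambda>k. if k \<in> {m1, m2} then 0 else 1 :: nat"
  define down :: "nat \<Rightarrow> complex" where
    "down = (\<lambda>i. if i = 0 then 0 else ?w (i - 1) * of_nat (d - (i - 1)))"
  define up :: "nat \<Rightarrow> complex" where "up = (\<lambda>i. if i < d then ?w (Suc i) * of_nat (Suc i) else 0)"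
  define down' where "down' = (\<lambda>i. if i = 0 then 0 else ?s (i - 1) * (d - (i - 1)))"
  define up' where "up' = (\<lambda>i. if i < d then ?s (Suc i) * Suc i else 0)"
  \<comment> \<open>The weights are 0 or 1, so the minor is the image of one over the natural
    numbers, and its nonvanishing carries over.\<close>
  have w: "?w k = of_nat (?s k)" for k by (simp add: weights_def)
  have eq: "down i = of_nat (down' i)" "up i = of_nat (up' i)" for i
    unfolding down_def down'_def up_def up'_def w by simp_all
  have "down' m1 * up' m2 \<noteq> up' m1 * down' m2"
    unfolding down'_def up'_def using shift_minor[of m1 m2 d] le dist excl by simp
  then have "(of_nat (down' m1 * up' m2) :: complex) \<noteq> of_nat (up' m1 * down' m2)"
    by (simp only: of_nat_eq_iff not_False_eq_True)
  then have "down m1 * up m2 - up m1 * down m2 \<noteq> 0" by (simp add: eq)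
  \<comment> \<open>At \<open>m1\<close> and \<open>m2\<close> the weight is 0 and no
    \<open>\<tau>\<close> is available, so only \<open>b2\<close> and \<open>b3\<close> act
    there.\<close>
  then obtain b2 b3 where b23: "down m1 * b2 + up m1 * b3 = h m1" "down m2 * b2 + up m2 * b3 = h m2"
    using solve_2x2 by meson
  define r where "r = (\<lambda>i. h i - down i * b2 - up i * b3)"
  \<comment> \<open>With \<open>b2\<close>, \<open>b3\<close> fixed, the coefficients at
    \<open>n1\<close>, \<open>n2\<close> are adjusted by \<open>b1\<close>, \<open>b4\<close>; this
    is the determinant of that system.\<close>
  have "of_nat (d - n1) * of_nat n2 - of_nat n1 * of_nat (d - n2)
      = (of_nat d * (of_nat n2 - of_nat n1) :: complex)"
    using le by (simp add: of_nat_diff algebra_simps)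
  also have "\<dots> \<noteq> 0" using d dist by auto
  finally obtain b1 b4 where b14: "of_nat (d - n1) * b1 + of_nat n1 * b4 = r n1"
    "of_nat (d - n2) * b1 + of_nat n2 * b4 = r n2" using solve_2x2 by meson
  \<comment> \<open>Every other coefficient has its own free parameter, which absorbs what is
    left.\<close>
  define \<tau> where "\<tau> = (\<lambda>i. r i - ?w i * (of_nat (d - i) * b1 + of_nat i * b4))"
  have "(if i \<in> {m1, m2, n1, n2} then 0 else \<tau> i) + ?w i * (of_nat (d - i) * b1 + of_nat i * b4)
      + down i * b2 + up i * b3 = h i" for i
  proof -
    consider "i \<in> {m1, m2}" | "i \<in> {n1, n2}" | "i \<notin> {m1, m2, n1, n2}" by blast
    then show ?thesis
    proof cases
      case 1
      then show ?thesis using b23 by (auto simp: weights_def)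
    next
      case 2
      then have "?w i = 1" using dist by (auto simp: weights_def)
      then show ?thesis using 2 b14 by (auto simp: r_def)
    next
      case 3
      then show ?thesis by (auto simp: \<tau>_def r_def)
    qed
  qed
  note sol = this[unfolded down_def up_def]
  show ?thesis by (intro that[of \<tau> b1 b4 b2 b3] allI impI) (rule sol)
qed

text \<open>Surjectivity of the differential realizes each velocity \<open>h\<close> by a curve of
  forms: the matrix is \<open>I + x B\<close> and the free coefficients are
  \<open>1 + x * \<tau> k\<close>. Near \<open>x = 0\<close> the curve stays in the image, where
  \<open>Q\<close> vanishes.\<close>

lemma has_normal_form_dense:
  assumes Q: "Q \<in> poly_fun d" and vanish: "\<And>c. has_normal_form c \<Longrightarrow> Q c = 0"
  shows "Q c = 0"
proof (rule poly_fun_zero_if_curves[OF Q, of "coeff (form_poly d (weights (\<lambda>_. 1)) 1 0 0 1)"])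
  fix h
  obtain b1 b2 b3 b4 \<tau> where h: "\<forall>i\<le>d.
    (if i \<in> {m1, m2, n1, n2} then 0 else \<tau> i) + weights (\<lambda>_. 1) i * (of_nat (d - i) * b1 + of_nat i * b4)
      + (if i = 0 then 0 else weights (\<lambda>_. 1) (i - 1) * of_nat (d - (i - 1))) * b2
      + (if i < d then weights (\<lambda>_. 1) (Suc i) * of_nat (Suc i) else 0) * b3 = h i"
    by (rule differential_surjective[of h])
  define p where "p = (\<lambda>x. form_poly d (weights (\<lambda>k. 1 + x * \<tau> k)) (1 + x * b1) (x * b2) (x * b3) (1 + x * b4))"
  have s: "((\<lambda>x. weights (\<lambda>k. 1 + x * \<tau> k) k) has_field_derivative
      (if k \<in> {m1, m2, n1, n2} then 0 else \<tau> k)) (at 0)" for k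
    by (cases "k \<in> {m1, m2}"; cases "k \<in> {n1, n2}")
      (auto simp: weights_def intro!: derivative_eq_intros)
  have "((\<lambda>x. coeff (p x) i) has_field_derivative h i) (at 0)" if "i \<le> d" for i
    unfolding p_def
    by (rule DERIV_cong[OF has_coeff_derivative_form_poly[OF s, unfolded has_coeff_derivative_def, rule_format]],
        subst coeff_form_poly_derivative[OF that]) (simp only: h[rule_format, OF that] mult_zero_left add_0_right)
  moreover have "\<forall>\<^sub>F x in at 0. Q (coeff (p x)) = 0"
  proof -
    have "((\<lambda>x. (1 + x * b1) * (1 + x * b4) - x * b2 * (x * b3)) \<longlongrightarrow>
        (1 + 0 * b1) * (1 + 0 * b4) - 0 * b2 * (0 * b3)) (at 0)" by (intro tendsto_intros)
    \<comment> \<open>The determinant equals 1 at \<open>x = 0\<close>, so the change of variables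
      is invertible for small \<open>x\<close>.\<close>
    then have "\<forall>\<^sub>F x in at 0. (1 + x * b1) * (1 + x * b4) - x * b2 * (x * b3) \<noteq> 0"
      by (rule tendsto_imp_eventually_ne) simp
    then show ?thesis
    proof eventually_elim
      case (elim x)
      then have "has_normal_form (coeff (p x))" unfolding has_normal_form_def p_def by blast
      then show ?case by (rule vanish)
    qed
  qed
  moreover have "p 0 = form_poly d (weights (\<lambda>_. 1)) 1 0 0 1" by (simp add: p_def)
  ultimately show "\<exists>g. (\<forall>i\<le>d. g 0 i = coeff (form_poly d (weights (\<lambda>_. 1)) 1 0 0 1) i \<and>
      ((\<lambda>x. g x i) has_field_derivative h i) (at 0)) \<and> (\<forall>\<^sub>F x in at 0. Q (g x) = 0)"
    by (intro exI[of _ "\<lambda>x. coeff (p x)"]) simp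
qed

lemma general_has_normal_form: "general d has_normal_form"
  using constructible_has_normal_form has_normal_form_dense by (rule general_if_constructible_dense)

end

theorem theorem2p4:
  fixes d m1 m2 n1 n2 :: nat
  assumes "d \<ge> 3"
    and "m1 \<le> d" "m2 \<le> d" "n1 \<le> d" "n2 \<le> d"
    and "distinct [m1, m2, n1, n2]"
    and "{m1, m2} \<noteq> {0, 1}" and "{m1, m2} \<noteq> {d - 1, d}"
  shows "general d (\<lambda>c. \<exists>a1 a2 a3 a4 :: complex. a1 * a4 - a2 * a3 \<noteq> 0 \<and>
           (\<exists>t :: nat \<Rightarrow> complex. \<forall>x y :: complex.
              binary_form d c x y =
                (a1*x + a2*y) ^ (d - n1) * (a3*x + a4*y) ^ n1
              + (a1*x + a2*y) ^ (d - n2) * (a3*x + a4*y) ^ n2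
              + (\<Sum>k\<in>{0..d} - {m1, m2, n1, n2}.
                   t k * (a1*x + a2*y) ^ (d - k) * (a3*x + a4*y) ^ k)))"
proof -
  interpret normal_form d m1 m2 n1 n2 using assms by unfold_locales
  obtain U where "zariski_open d U" "U \<noteq> {}" "\<forall>c\<in>U. has_normal_form c"
    using general_has_normal_form unfolding general_def by blast
  then show ?thesis unfolding general_def using has_normal_formD by (intro exI[of _ U]) blast
qed

end
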